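(* Let $M\ge1$ be an integer. For every $m\ge0$, $$f_m^{[M]}(t)=t^{(M-1)m}f_m^{[M]}(t^{-1}).$$ Thus $(-1)^mf_m^{[M]}(t)$ is a palindromic polynomial with darga $(M-1)m$.
   Context: Let $t$ be an indeterminate. The coefficients $f_m^{[M]}(t)$ are defined by $F_{t,t^M}(u)=\sum_{m\ge0}f_m^{[M]}(t)u^m$, where $$F_{t,s}(u)=\exp\Big(-2\sum_{n\ge1,\ n\text{ odd}}\frac{1-s^n}{1-t^n}\frac{u^n}{n}\Big)$$ as a formal power series in $u$. A polynomial $f(t)$ is called palindromic of darga $d$ if $f(t)=t^df(t^{-1})$; this convention permits zero coefficients at both ends of the degree interval $[0,d]$. *)

theory Defs
  imports
    "HOL-Computational_Algebra.Computational_Algebra"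
    "HOL-Computational_Algebra.Field_as_Ring"
begin

definition F_exponent :: "'a :: field_char_0 \<Rightarrow> 'a \<Rightarrow> 'a fps" where
  "F_exponent t s =
     Abs_fps (\<lambda>n. if odd n then (1 - s ^ n) / (1 - t ^ n) / of_nat n else 0)"

text \<open>
  \<open>F_exponent t s\<close> has zero constant term, so the composition below is the exponential of
  the power series \<open>- 2 * F_exponent t s\<close>.
\<close>

definition F :: "'a :: field_char_0 \<Rightarrow> 'a \<Rightarrow> 'a fps" where
  "F t s = fps_exp 1 oo (fps_const (- 2) * F_exponent t s)"

text \<open>
  We work over the field of rational functions in one indeterminate with rational
  coefficients, rendered as \<^typ>\<open>rat poly fract\<close>.
\<close>

definition indet :: "rat poly fract" where
  "indet = to_fract [:0, 1:]"

definition poly_at :: "rat poly \<Rightarrow> rat poly fract \<Rightarrow> rat poly fract" where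
  "poly_at p x = poly (map_poly (\<lambda>c. to_fract [:c:]) p) x"

text \<open>
  \<open>ratfun_at r x\<close> is the rational function \<open>r(t)\<close> with \<open>x\<close> substituted for \<open>t\<close>. It is
  defined through the coprime representation of \<open>r\<close>; by \<open>ratfun_at_Fract\<close> below any
  other representation whose denominator does not vanish at \<open>x\<close> gives the same value.
\<close>

definition ratfun_at :: "rat poly fract \<Rightarrow> rat poly fract \<Rightarrow> rat poly fract" where
  "ratfun_at r x = poly_at (fst (quot_of_fract r)) x / poly_at (snd (quot_of_fract r)) x"

definition f_coeff :: "nat \<Rightarrow> nat \<Rightarrow> rat poly fract" where
  "f_coeff M m = fps_nth (F indet (indet ^ M)) m"

definition palindromic :: "nat \<Rightarrow> rat poly \<Rightarrow> bool" where
  "palindromic d p \<longleftrightarrow> to_fract p = indet ^ d * poly_at p (inverse indet)"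

lemma poly_at_mult: "poly_at (p * q) x = poly_at p x * poly_at q x"
proof -
  have "map_poly (\<lambda>c. to_fract [:c:]) (p * q) =
          map_poly (\<lambda>c. to_fract [:c:]) p * map_poly (\<lambda>c. to_fract [:c:]) q"
  proof (rule poly_eqI)
    fix n
    have add: "to_fract [:a + b:] = to_fract [:a:] + to_fract [:b:]" for a b :: rat
      by (simp only: flip: to_fract_add) simp
    have *: "to_fract [:\<Sum>i\<in>A. g i:] = (\<Sum>i\<in>A. to_fract [:g i:])"
      for A :: "nat set" and g :: "nat \<Rightarrow> rat"
    proof (induction A rule: infinite_finite_induct)
      case (insert i A)
      then show ?case
        by (simp add: add)
    qed auto
    have **: "to_fract [:a * b:] = to_fract [:a:] * to_fract [:b:]" for a b :: rat
      by (simp only: flip: to_fract_mult) simp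
    show "coeff (map_poly (\<lambda>c. to_fract [:c:]) (p * q)) n =
          coeff (map_poly (\<lambda>c. to_fract [:c:]) p * map_poly (\<lambda>c. to_fract [:c:]) q) n"
      by (simp add: coeff_map_poly coeff_mult * ** )
  qed
  then show ?thesis
    by (simp add: poly_at_def)
qed

lemma ratfun_at_Fract:
  assumes "poly_at q x \<noteq> 0"
  shows "ratfun_at (Fract p q) x = poly_at p x / poly_at q x"
proof -
  define a b where "a = fst (quot_of_fract (Fract p q))" and "b = snd (quot_of_fract (Fract p q))"
  have q0: "q \<noteq> 0"
    using assms by (auto simp: poly_at_def)
  have b0: "b \<noteq> 0"
    by (simp add: b_def)
  have "Fract a b = Fract p q"
    by (metis a_def b_def prod.collapse quot_to_fract_def quot_to_fract_quot_of_fract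
        case_prod_conv fst_conv snd_conv)
  then have eq: "a * q = p * b"
    using q0 b0 by (simp add: eq_fract)
  have "coprime a b"
    by (simp add: a_def b_def coprime_quot_of_fract)
  moreover have "b dvd a * q"
    by (simp add: eq)
  ultimately have "b dvd q"
    by (simp add: coprime_commute coprime_dvd_mult_right_iff)
  then obtain c where "q = b * c" ..
  then have "poly_at b x \<noteq> 0"
    using assms by (auto simp: poly_at_mult)
  moreover have "poly_at a x * poly_at q x = poly_at p x * poly_at b x"
    using eq by (metis poly_at_mult)
  ultimately show ?thesis
    using assms by (simp add: ratfun_at_def frac_eq_eq flip: a_def b_def)
qed

end

theory Submission
  imports Defs
begin

text \<open>
  For \<open>s = t ^ M\<close> the quotient \<open>(1 - s ^ n) / (1 - t ^ n)\<close> is the geometric sum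
  \<open>\<Sum>k<M. (t ^ k) ^ n\<close>. Since \<open>exp (- 2 * (\<Sum>n odd. x ^ n / n)) = (1 - x) / (1 + x)\<close>, the
  generating function factors (lemma \<open>F_power_eq_prod\<close>) as
  \<open>F t (t ^ M) = (\<Prod>k<M. (1 - t ^ k * u) / (1 + t ^ k * u))\<close>.

  Each factor has coefficients in \<open>\<int>[t]\<close>, so each coefficient of the product is a polynomial
  in \<open>t\<close>. Replacing \<open>t\<close> by \<open>1 / t\<close> and \<open>u\<close> by \<open>t ^ (M - 1) * u\<close> only reverses the order of
  the factors, because \<open>t ^ (M - 1) * (1 / t) ^ k = t ^ (M - 1 - k)\<close>; comparing the
  coefficients of \<open>u ^ m\<close> gives the symmetry.

  The identities between power series are obtained from the uniqueness of the solution of a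
  linear differential equation \<open>A' = A * D\<close> with given constant term. The substitution
  \<open>t \<mapsto> 1 / t\<close> and the embedding of polynomials into rational functions are both treated as
  ring homomorphisms acting on the coefficients of the product.
\<close>

section \<open>Exponentials of formal power series\<close>

text \<open>The quotient of two solutions has derivative \<open>0\<close>, hence is constant.\<close>

lemma fps_linear_ode_unique:
  fixes A B D :: "'a :: field_char_0 fps"
  assumes "fps_deriv A = A * D" and "fps_deriv B = B * D"
    and "fps_nth A 0 = fps_nth B 0" and "fps_nth B 0 \<noteq> 0"
  shows "A = B"
proof -
  define I where "I = inverse B"
  have inv: "B * I = 1"
    using assms(4) by (simp add: I_def inverse_mult_eq_1')
  have "fps_deriv (A * I) * B = A * (B * fps_deriv I + fps_deriv B * I)"
    by (simp add: assms(1,2) algebra_simps)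
  also have "B * fps_deriv I + fps_deriv B * I = fps_deriv (B * I)"
    by simp
  also have "\<dots> = 0"
    by (simp only: inv) simp
  finally have "fps_deriv (A * I) = 0"
    using assms(4) by auto
  then have "A * I = fps_const (fps_nth (A * I) 0)"
    by (simp only: fps_deriv_eq_0_iff)
  also have "\<dots> = 1"
    using assms(3,4) by (simp add: I_def)
  finally have "A * I = 1" .
  have "A = A * (B * I)"
    by (simp add: inv)
  also have "\<dots> = A * I * B"
    by (simp only: ac_simps)
  also have "\<dots> = B"
    by (simp only: \<open>A * I = 1\<close> mult_1)
  finally show ?thesis .
qed

lemma fps_deriv_exp_compose:
  fixes f :: "'a :: field_char_0 fps"
  assumes "fps_nth f 0 = 0"
  shows "fps_deriv (fps_exp 1 oo f) = (fps_exp 1 oo f) * fps_deriv f"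
  using assms by (simp add: fps_compose_deriv)

lemma fps_exp_compose_add:
  fixes f g :: "'a :: field_char_0 fps"
  assumes "fps_nth f 0 = 0" and "fps_nth g 0 = 0"
  shows "fps_exp 1 oo (f + g) = (fps_exp 1 oo f) * (fps_exp 1 oo g)"
proof (rule fps_linear_ode_unique)
  show "fps_deriv (fps_exp 1 oo (f + g)) = (fps_exp 1 oo (f + g)) * fps_deriv (f + g)"
    using assms by (intro fps_deriv_exp_compose) simp
  show "fps_deriv ((fps_exp 1 oo f) * (fps_exp 1 oo g)) =
          (fps_exp 1 oo f) * (fps_exp 1 oo g) * fps_deriv (f + g)"
    using assms by (simp add: fps_deriv_exp_compose algebra_simps)
qed simp_all

lemma fps_exp_compose_sum:
  fixes f :: "'b \<Rightarrow> 'a :: field_char_0 fps"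
  assumes "finite S" and "\<And>k. k \<in> S \<Longrightarrow> fps_nth (f k) 0 = 0"
  shows "fps_exp 1 oo (\<Sum>k\<in>S. f k) = (\<Prod>k\<in>S. fps_exp 1 oo f k)"
  using assms
proof (induction S rule: finite_induct)
  case empty
  then show ?case
    by (simp add: fps_compose_0_right)
next
  case (insert k S)
  then show ?case
    by (simp add: fps_exp_compose_add fps_sum_nth)
qed


section \<open>The product formula\<close>

text \<open>
  The power series \<open>(1 - a * u) / (1 + a * u)\<close>, given by its coefficients so that it makes
  sense over every commutative ring.
\<close>

definition cayley_fps :: "'a :: comm_ring_1 \<Rightarrow> 'a fps" where
  "cayley_fps a = Abs_fps (\<lambda>n. if n = 0 then 1 else 2 * (- a) ^ n)"

lemma cayley_fps_mult_linear:
  "cayley_fps a * (1 + fps_const a * fps_X) = 1 - fps_const a * fps_X"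
proof (rule fps_ext)
  fix n
  have *: "cayley_fps a * (1 + fps_const a * fps_X)
             = cayley_fps a + fps_const a * (fps_X * cayley_fps a)"
    by (simp add: algebra_simps)
  show "fps_nth (cayley_fps a * (1 + fps_const a * fps_X)) n =
          fps_nth (1 - fps_const a * fps_X) n"
    unfolding * by (auto simp: cayley_fps_def power_eq_if[of _ n])
qed

text \<open>The logarithm of \<open>cayley_fps a\<close>.\<close>

definition log_cayley_fps :: "'a :: field_char_0 \<Rightarrow> 'a fps" where
  "log_cayley_fps a = fps_const (- 2) * Abs_fps (\<lambda>n. if odd n then a ^ n / of_nat n else 0)"

lemma log_cayley_fps_nth_0 [simp]: "fps_nth (log_cayley_fps a) 0 = 0"
  by (simp add: log_cayley_fps_def)

lemma fps_deriv_log_cayley: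
  fixes a :: "'a :: field_char_0"
  shows "fps_deriv (log_cayley_fps a) * ((1 - fps_const a * fps_X) * (1 + fps_const a * fps_X))
           = fps_const (- 2 * a)"
proof -
  define D where "D = fps_deriv (log_cayley_fps a)"
  have nth: "fps_nth D n = (if even n then - 2 * a ^ Suc n else 0)" for n
    by (simp add: D_def log_cayley_fps_def del: of_nat_Suc)
  have "D * ((1 - fps_const a * fps_X) * (1 + fps_const a * fps_X))
          = D - fps_const (a ^ 2) * (fps_X ^ 2 * D)"
    by (simp add: algebra_simps power2_eq_square flip: fps_const_mult)
  also have "\<dots> = fps_const (- 2 * a)"
  proof (rule fps_ext)
    fix n
    consider "n = 0" | "n = 1" | k where "n = Suc (Suc k)"
      by (metis One_nat_def not0_implies_Suc)
    then show "fps_nth (D - fps_const (a ^ 2) * (fps_X ^ 2 * D)) n = fps_nth (fps_const (- 2 * a)) n"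
      by cases (simp_all add: nth fps_X_power_mult_nth, simp add: power2_eq_square)
  qed
  finally show ?thesis
    by (simp add: D_def)
qed

lemma fps_exp_log_cayley:
  fixes a :: "'a :: field_char_0"
  shows "fps_exp 1 oo log_cayley_fps a = cayley_fps a"
proof (rule fps_linear_ode_unique)
  define c P Q where "c = fps_const a" and "P = 1 + c * fps_X" and "Q = 1 - c * fps_X"
  define D where "D = fps_deriv (log_cayley_fps a)"
  define C where "C = cayley_fps a"
  have CP: "C * P = Q"
    using cayley_fps_mult_linear by (simp add: C_def P_def Q_def c_def)
  have DQP: "D * (Q * P) = - 2 * c"
    using fps_deriv_log_cayley[of a]
    by (simp add: D_def P_def Q_def c_def fps_numeral_fps_const flip: fps_const_neg fps_const_mult)
  have "fps_nth P 0 \<noteq> 0"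
    by (simp add: P_def)
  then have "P \<noteq> 0"
    by auto
  have "fps_deriv C * P + C * c = - c"
    using arg_cong[OF CP, of fps_deriv] by (simp add: P_def Q_def c_def algebra_simps)
  \<comment> \<open>\<open>P ^ 2\<close> times the derivative of \<open>C\<close> and \<open>P ^ 2\<close> times \<open>C * D\<close> both equal \<open>- 2 * c\<close>.\<close>
  then have "fps_deriv C * P * P = (- c - C * c) * P"
    by (metis add_diff_cancel_right')
  also have "\<dots> = - c * P - C * P * c"
    by (simp add: algebra_simps)
  also have "\<dots> = - 2 * c"
    by (simp add: CP) (simp add: P_def Q_def algebra_simps)
  also have "\<dots> = D * (C * P * P)"
    by (simp only: CP DQP)
  also have "\<dots> = C * D * P * P"
    by (simp only: ac_simps)
  finally have "fps_deriv C = C * D"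
    using \<open>P \<noteq> 0\<close> by simp
  then show "fps_deriv (cayley_fps a) = cayley_fps a * fps_deriv (log_cayley_fps a)"
    by (simp add: C_def D_def)
  show "fps_deriv (fps_exp 1 oo log_cayley_fps a) =
          (fps_exp 1 oo log_cayley_fps a) * fps_deriv (log_cayley_fps a)"
    by (simp add: fps_deriv_exp_compose)
qed (simp_all add: cayley_fps_def)

text \<open>
  For odd \<open>n\<close> with \<open>t ^ n = 1\<close> the quotient in \<open>F_exponent\<close> is \<open>0\<close> by the convention on
  division by zero, whereas the geometric sum is \<open>M\<close>; hence the assumption.
\<close>

lemma F_power_eq_prod:
  fixes t :: "'a :: field_char_0"
  assumes "\<And>n. odd n \<Longrightarrow> t ^ n \<noteq> 1"
  shows "F t (t ^ M) = (\<Prod>k<M. cayley_fps (t ^ k))"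
proof -
  have geometric: "(1 - (t ^ M) ^ n) / (1 - t ^ n) = (\<Sum>k<M. (t ^ k) ^ n)" if "odd n" for n
    using assms[OF that] sum_gp_strict[of "t ^ n" M]
    by (simp add: mult.commute flip: power_mult)
  have "fps_const (- 2) * F_exponent t (t ^ M) = (\<Sum>k<M. log_cayley_fps (t ^ k))"
    by (rule fps_ext)
       (auto simp: F_exponent_def log_cayley_fps_def fps_sum_nth geometric
          sum_distrib_left sum_divide_distrib sum_negf)
  then have "F t (t ^ M) = fps_exp 1 oo (\<Sum>k<M. log_cayley_fps (t ^ k))"
    by (simp only: F_def)
  also have "\<dots> = (\<Prod>k<M. cayley_fps (t ^ k))"
    by (simp add: fps_exp_compose_sum fps_exp_log_cayley)
  finally show ?thesis .
qed


section \<open>Homomorphisms and scaling\<close>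

lemma ring_hom_prod_cayley_nth:
  fixes h :: "'a :: comm_ring_1 \<Rightarrow> 'b :: comm_ring_1" and M n :: nat
  assumes add: "\<And>x y. h (x + y) = h x + h y"
    and mult: "\<And>x y. h (x * y) = h x * h y" and one: "h 1 = 1"
  shows "h (fps_nth (\<Prod>k<M. cayley_fps (a k)) n) = fps_nth (\<Prod>k<M. cayley_fps (h (a k))) n"
proof -
  have zero: "h 0 = 0"
    using add[of 0 0] by simp
  have minus: "h (- x) = - h x" for x
    using add[of "- x" x] by (simp add: zero eq_neg_iff_add_eq_0)
  have pow: "h (x ^ i) = h x ^ i" for x i
    by (induction i) (simp_all add: one mult)
  have sum: "h (\<Sum>i\<in>S. g i) = (\<Sum>i\<in>S. h (g i))" for g and S :: "nat set"
    by (induction S rule: infinite_finite_induct) (simp_all add: zero add)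
  have cayley: "h (fps_nth (cayley_fps x) i) = fps_nth (cayley_fps (h x)) i" for x i
    using add[of 1 1] by (simp add: cayley_fps_def one mult pow minus)
  show ?thesis
    by (induction M arbitrary: n)
       (simp_all add: zero one fps_mult_nth sum mult cayley)
qed

text \<open>Replacing \<open>u\<close> by \<open>c * u\<close> multiplies the coefficient of \<open>u ^ n\<close> by \<open>c ^ n\<close>.\<close>

lemma prod_cayley_scale_nth:
  fixes c :: "'a :: comm_ring_1" and M n :: nat
  shows "fps_nth (\<Prod>k<M. cayley_fps (c * a k)) n = c ^ n * fps_nth (\<Prod>k<M. cayley_fps (a k)) n"
proof (induction M arbitrary: n)
  case 0
  then show ?case
    by simp
next
  case (Suc M)
  have cayley: "fps_nth (cayley_fps (c * x)) i = c ^ i * fps_nth (cayley_fps x) i" for x i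
    by (simp add: cayley_fps_def power_mult_distrib flip: mult_minus_right)
  have scale: "c ^ i * x * (c ^ (n - i) * y) = c ^ n * (x * y)" if "i \<le> n" for i x y
  proof -
    have "c ^ n = c ^ i * c ^ (n - i)"
      using that by (simp flip: power_add)
    then show ?thesis
      by (simp add: algebra_simps)
  qed
  then show ?case
    by (auto simp: fps_mult_nth Suc.IH cayley sum_distrib_left scale intro!: sum.cong)
qed

lemma prod_cayley_reciprocal_nth:
  fixes t :: "'a :: field"
  assumes "t \<noteq> 0"
  shows "fps_nth (\<Prod>k<M. cayley_fps (t ^ k)) n =
           t ^ ((M - 1) * n) * fps_nth (\<Prod>k<M. cayley_fps (inverse t ^ k)) n"
proof -
  have "(\<Prod>k<M. cayley_fps (t ^ k)) = (\<Prod>k<M. cayley_fps (t ^ (M - Suc k)))"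
    by (rule prod.nat_diff_reindex[symmetric])
  also have "\<dots> = (\<Prod>k<M. cayley_fps (t ^ (M - 1) * inverse t ^ k))"
  proof (rule prod.cong)
    fix k
    assume "k \<in> {..<M}"
    then have "t ^ (M - 1 - k) = t ^ (M - 1) / t ^ k"
      using assms by (intro power_diff) auto
    then show "cayley_fps (t ^ (M - Suc k)) = cayley_fps (t ^ (M - 1) * inverse t ^ k)"
      by (simp add: divide_inverse power_inverse)
  qed simp
  finally show ?thesis
    by (simp add: prod_cayley_scale_nth power_mult)
qed


section \<open>Substitution into rational functions\<close>

lemma poly_at_add: "poly_at (p + q) x = poly_at p x + poly_at q x"
proof -
  have add: "to_fract [:a + b:] = to_fract [:a:] + to_fract [:b:]" for a b :: rat
    by (simp only: flip: to_fract_add) simp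
  have "map_poly (\<lambda>c. to_fract [:c:]) (p + q) =
          map_poly (\<lambda>c. to_fract [:c:]) p + map_poly (\<lambda>c. to_fract [:c:]) q"
    by (rule poly_eqI) (simp add: coeff_map_poly add)
  then show ?thesis
    by (simp add: poly_at_def)
qed

lemma poly_at_1: "poly_at 1 x = 1"
  by (simp add: poly_at_def map_poly_1 flip: one_pCons)

lemma poly_at_monomial: "poly_at ([:0, 1:] ^ k) x = x ^ k"
proof (induction k)
  case (Suc k)
  moreover have "poly_at [:0, 1:] x = x"
    by (simp add: poly_at_def map_poly_pCons flip: one_pCons)
  ultimately show ?case
    by (simp add: poly_at_mult del: mult_pCons_left)
qed (simp add: poly_at_1)

lemma ratfun_at_to_fract: "ratfun_at (to_fract p) x = poly_at p x"
  using ratfun_at_Fract[of 1 x p] by (simp add: to_fract_def poly_at_1)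

lemma to_fract_power: "to_fract (p ^ k) = to_fract p ^ k"
  by (induction k) simp_all

lemma indet_nonzero: "indet \<noteq> 0"
  by (simp add: indet_def)

lemma indet_power_neq_1:
  assumes "odd n"
  shows "indet ^ n \<noteq> 1"
proof
  assume "indet ^ n = 1"
  then have "to_fract ([:0, 1:] ^ n :: rat poly) = to_fract 1"
    by (simp add: indet_def to_fract_power)
  then have "([:0, 1:] ^ n :: rat poly) = 1"
    by (simp only: to_fract_eq_iff)
  then have "poly ([:0, 1:] ^ n :: rat poly) 0 = 1"
    by simp
  with assms show False
    by (cases n) simp_all
qed


section \<open>Palindromicity of the coefficients\<close>

theorem corollary4p3:
  fixes M m :: nat
  assumes "M \<ge> 1"
  shows "f_coeff M m = indet ^ ((M - 1) * m) * ratfun_at (f_coeff M m) (inverse indet) \<and>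
         (\<exists>p :: rat poly. to_fract p = (- 1) ^ m * f_coeff M m \<and> palindromic ((M - 1) * m) p)"
proof -
  define q :: "rat poly" where "q = fps_nth (\<Prod>k<M. cayley_fps ([:0, 1:] ^ k)) m"
  have f: "f_coeff M m = fps_nth (\<Prod>k<M. cayley_fps (indet ^ k)) m"
    by (simp add: f_coeff_def F_power_eq_prod indet_power_neq_1)
  have fq: "f_coeff M m = to_fract q"
    unfolding f q_def
    by (subst ring_hom_prod_cayley_nth) (simp_all add: to_fract_power indet_def)
  have q_inv: "poly_at q (inverse indet) = fps_nth (\<Prod>k<M. cayley_fps (inverse indet ^ k)) m"
    unfolding q_def
    by (subst ring_hom_prod_cayley_nth[where h = "\<lambda>p. poly_at p (inverse indet)"])
       (simp_all only: poly_at_add poly_at_mult poly_at_1 poly_at_monomial)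
  have sym: "to_fract q = indet ^ ((M - 1) * m) * poly_at q (inverse indet)"
    unfolding q_inv fq[symmetric] f by (rule prod_cayley_reciprocal_nth[OF indet_nonzero])
  have sign: "poly_at (- p) x = - poly_at p x" for p x
    using poly_at_add[of "- p" p x] by (simp add: poly_at_def eq_neg_iff_add_eq_0)
  have "to_fract ((- 1) ^ m * q) = (- 1) ^ m * f_coeff M m"
    by (simp add: to_fract_power fq)
  moreover have "palindromic ((M - 1) * m) ((- 1) ^ m * q)"
    using sym by (cases "even m") (simp_all add: palindromic_def sign)
  ultimately have "\<exists>p. to_fract p = (- 1) ^ m * f_coeff M m \<and> palindromic ((M - 1) * m) p"
    by blast
  with sym show ?thesis
    unfolding fq ratfun_at_to_fract by blast
qed

end
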